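(* Let $\lambda(z)=\frac{\alpha(z)}{\beta(z)}(1-z^s)^{-d}=\sum_{k=0}^\infty\lambda_{d,k}z^k$, $|z|<1$. Suppose $\alpha(\cdot)$ and $\beta(\cdot)$ have no common roots and $\beta(z)\neq0$ in the closed disk $\{z:|z|\le1\}$. Then the coefficients $\lambda_{d,k}$ are given by $\lambda_{d,0}=1$ and, for $k\ge1$, $$\lambda_{d,k}=\begin{cases}-\alpha_k+\displaystyle\sum_{i=0}^{k-1}\lambda_{d,i}\Big(\sum_{j=0}^{(k-i)\wedge q}\delta^*_{d,\frac{k-i-j}{s}}\,\beta_j\Big),& k\le p,\\[3mm]\displaystyle\sum_{i=0}^{k-1}\lambda_{d,i}\Big(\sum_{j=0}^{(k-i)\wedge q}\delta^*_{d,\frac{k-i-j}{s}}\,\beta_j\Big),& k>p,\end{cases}$$ where $(k-i)\wedge q=\min\{k-i,q\}$, and $\delta^*_{d,m}=\delta_{d,m}$ if $m\in\mathbb N$, $\delta^*_{d,m}=0$ if $m\notin\mathbb N$.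
   Context: $\mathbb N=\{0,1,2,\dots\}$. Here $d\in\mathbb R$, $s\ge1$ is an integer, and $\alpha(z)=\sum_{i=0}^p(-\alpha_i)z^i$, $\beta(z)=\sum_{j=0}^q(-\beta_j)z^j$ are real polynomials of orders $p,q\ge0$ with $\alpha_0=\beta_0=-1$. The numbers $\delta_{d,m}$, $m\in\mathbb N$, are the Maclaurin coefficients of $(1-z)^d=\sum_{m=0}^\infty\delta_{d,m}z^m$, i.e. $\delta_{d,m}=\frac{\Gamma(m-d)}{\Gamma(m+1)\Gamma(-d)}$ (read as $(-d)(1-d)\cdots(m-1-d)/m!$). *)

theory Defs
  imports "HOL-Complex_Analysis.Complex_Analysis"
begin

text \<open>
  The polynomial \<open>\<Sum>i\<le>n. (- a\<^sub>i) z\<^sup>i\<close> of a real sequence \<open>a\<close>. It lives over the complex numbers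
  because roots and the unit disk are complex throughout.
\<close>
definition neg_coeff_poly :: "(nat \<Rightarrow> real) \<Rightarrow> nat \<Rightarrow> complex poly" where
  "neg_coeff_poly a n = (\<Sum>i\<le>n. monom (of_real (- a i)) i)"

text \<open>
  \<open>(-d)(1-d)\<dots>(m-1-d)/m!\<close>; for \<open>d\<close> not a natural number this is
  \<open>\<Gamma>(m-d) / (\<Gamma>(m+1) \<Gamma>(-d))\<close>.
\<close>
definition delta :: "real \<Rightarrow> nat \<Rightarrow> real" where
  "delta d m = pochhammer (- d) m / fact m"

lemma delta_sums:
  assumes "norm (z :: complex) < 1"
  shows "(\<lambda>m. of_real (delta d m) * z ^ m) sums ((1 - z) powr of_real d)"
proof -
  have "complex_of_real (delta d m) * z ^ m = (of_real d gchoose m) * (- z) ^ m" for m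
  proof -
    have "(- z) ^ m = (- 1) ^ m * z ^ m"
      by (rule power_minus)
    thus ?thesis
      by (simp add: delta_def gbinomial_pochhammer pochhammer_of_real [symmetric]
          flip: of_real_minus power_mult_distrib)
  qed
  thus ?thesis
    using gen_binomial_complex [of "- z" "of_real d"] assms by simp
qed

definition delta_star :: "real \<Rightarrow> real \<Rightarrow> real" where
  "delta_star d x = (if x \<in> \<nat> then delta d (nat \<lfloor>x\<rfloor>) else 0)"

text \<open>
  For \<open>norm z < 1\<close> and \<open>s \<ge> 1\<close> the base \<open>1 - z ^ s\<close> has positive real part, so the
  principal branch taken by \<open>powr\<close> is the analytic one with value 1 at \<open>z = 0\<close>.
\<close>
definition lambda_fun ::
  "real \<Rightarrow> nat \<Rightarrow> (nat \<Rightarrow> real) \<Rightarrow> nat \<Rightarrow> (nat \<Rightarrow> real) \<Rightarrow> nat \<Rightarrow> complex \<Rightarrow> complex" where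
  "lambda_fun d s \<alpha> p \<beta> q z =
     poly (neg_coeff_poly \<alpha> p) z / poly (neg_coeff_poly \<beta> q) z * (1 - z ^ s) powr (of_real (- d))"

text \<open>The Maclaurin coefficients; they are complex only by type.\<close>
definition lambda_coeff ::
  "real \<Rightarrow> nat \<Rightarrow> (nat \<Rightarrow> real) \<Rightarrow> nat \<Rightarrow> (nat \<Rightarrow> real) \<Rightarrow> nat \<Rightarrow> nat \<Rightarrow> complex" where
  "lambda_coeff d s \<alpha> p \<beta> q k = fps_nth (fps_expansion (lambda_fun d s \<alpha> p \<beta> q) 0) k"

end

theory Submission
  imports Defs
begin

text \<open>
  The recursion is the identity
  \<^prop>\<open>lambda_fun d s \<alpha> p \<beta> q z * (poly (neg_coeff_poly \<beta> q) z * (1 - z ^ s) powr of_real d) =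
        poly (neg_coeff_poly \<alpha> p) z\<close>
  read off coefficient by coefficient. It expresses \<open>\<lambda>\<close> by multiplication only, so no reciprocal
  power series has to be computed. The second factor \<open>\<beta>(z) (1 - z\<^sup>s)\<^sup>d\<close> is known explicitly: the
  coefficient of \<open>z\<^sup>n\<close> in \<open>(1 - z\<^sup>s)\<^sup>d\<close> is \<open>\<delta>\<^sup>*\<close> at \<open>n/s\<close>, because substituting \<open>z\<^sup>s\<close> into
  the binomial series only spreads out its coefficients
  (\<open>one_minus_power_powr_has_fps_expansion\<close>), and multiplying by \<open>\<beta>\<close> gives a sum of
  \<open>min n q + 1\<close> terms (\<open>coeff_beta_times_delta_star\<close>). Its constant term is \<open>1\<close>, so in the
  Cauchy product of index \<open>k\<close> the coefficient \<open>\<lambda>\<^sub>k\<close> appears with factor \<open>1\<close> and can be isolated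
  (\<open>fps_mult_solve_nth\<close>).

  The power series of \<open>\<lambda>\<close> represents it on the whole unit disk because \<open>\<lambda>\<close> is holomorphic there:
  \<open>\<beta>\<close> has no zero in the disk, and \<open>1 - z\<^sup>s\<close> stays in the right half-plane, away from the branch
  cut of \<open>powr\<close>. On the level of formal power series the functional identity follows from the
  uniqueness of Maclaurin expansions.
\<close>

lemma coeff_neg_coeff_poly:
  "coeff (neg_coeff_poly a n) i = (if i \<le> n then of_real (- a i) else 0)"
  by (simp add: neg_coeff_poly_def coeff_sum if_distrib cong: if_cong)

lemma has_fps_expansion_fps_of_poly:
  fixes p :: "'a :: {banach, real_normed_field} poly"
  shows "poly p has_fps_expansion fps_of_poly p"
  by (simp add: has_fps_expansion_def)

lemma Re_one_minus_power_pos: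
  fixes z :: complex
  assumes "norm z < 1" and "s \<ge> 1"
  shows "Re (1 - z ^ s) > 0"
proof -
  have "Re (z ^ s) \<le> norm z ^ s"
    using complex_Re_le_cmod[of "z ^ s"] by (simp add: norm_power)
  also have "\<dots> < 1"
    using assms by (simp add: power_less_one_iff)
  finally show ?thesis
    by simp
qed

text \<open>
  The non-integral arguments of \<^const>\<open>delta_star\<close> are exactly the positions skipped when \<open>z\<close> is
  replaced by \<open>z\<^sup>s\<close> in the binomial series.
\<close>
lemma delta_star_sums:
  fixes z :: complex
  assumes "norm z < 1" and s: "s \<ge> 1"
  shows "(\<lambda>n. of_real (delta_star d (real n / real s)) * z ^ n) sums
           ((1 - z ^ s) powr of_real d)"
proof -
  let ?f = "\<lambda>n. complex_of_real (delta_star d (real n / real s)) * z ^ n"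
  have "norm (z ^ s) < 1"
    using assms by (simp add: norm_power power_less_one_iff)
  then have "(\<lambda>m. complex_of_real (delta d m) * (z ^ s) ^ m) sums ((1 - z ^ s) powr of_real d)"
    by (rule delta_sums)
  also have "(\<lambda>m. complex_of_real (delta d m) * (z ^ s) ^ m) = (\<lambda>m. ?f (s * m))"
    using s by (simp add: delta_star_def power_mult fun_eq_iff)
  finally have "(\<lambda>m. ?f (s * m)) sums ((1 - z ^ s) powr of_real d)" .
  moreover have "?f n = 0" if n: "n \<notin> range ((*) s)" for n
  proof -
    have "real n / real s \<notin> \<nat>"
    proof
      assume "real n / real s \<in> \<nat>"
      then obtain m where "real n / real s = real m"
        by (auto elim: Nats_cases)
      then have "real n = real (s * m)"
        using s by (simp add: field_simps)
      then have "n = s * m"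
        by (simp only: of_nat_eq_iff)
      with n show False
        by blast
    qed
    then show ?thesis
      by (simp add: delta_star_def)
  qed
  moreover have "strict_mono ((*) s)"
    using s by (simp add: strict_mono_def)
  ultimately show ?thesis
    using sums_mono_reindex[of "(*) s" ?f] by blast
qed

lemma one_minus_power_powr_has_fps_expansion:
  assumes "s \<ge> 1"
  shows "(\<lambda>z :: complex. (1 - z ^ s) powr of_real d) has_fps_expansion
           Abs_fps (\<lambda>n. of_real (delta_star d (real n / real s)))"
proof (rule has_fps_expansionI)
  have "eventually (\<lambda>z :: complex. z \<in> ball 0 1) (nhds 0)"
    by (intro eventually_nhds_in_open) auto
  then show "\<forall>\<^sub>F z :: complex in nhds 0.
      (\<lambda>n. Abs_fps (\<lambda>n. of_real (delta_star d (real n / real s))) $ n * z ^ n) sums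
        ((1 - z ^ s) powr of_real d)"
    by eventually_elim (use delta_star_sums assms in auto)
qed

lemma coeff_beta_times_delta_star:
  "(fps_of_poly (neg_coeff_poly \<beta> q) *
      Abs_fps (\<lambda>n. of_real (delta_star d (real n / real s)))) $ n =
   - of_real (\<Sum>j = 0..min n q. delta_star d (real (n - j) / real s) * \<beta> j)"
proof -
  let ?t = "\<lambda>j. complex_of_real (delta_star d (real (n - j) / real s) * \<beta> j)"
  have "(fps_of_poly (neg_coeff_poly \<beta> q) *
      Abs_fps (\<lambda>n. of_real (delta_star d (real n / real s)))) $ n =
      (\<Sum>j = 0..n. if j \<le> q then - ?t j else 0)"
    unfolding fps_mult_nth
    by (intro sum.cong) (auto simp: coeff_neg_coeff_poly)
  also have "\<dots> = (\<Sum>j = 0..min n q. - ?t j)"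
    by (rule sum.mono_neutral_cong_right) auto
  finally show ?thesis
    by (simp add: sum_negf)
qed

text \<open>
  Division by a power series with constant term \<open>1\<close>: the top term of the Cauchy product contains
  the unknown coefficient with factor \<open>1\<close>, and all other terms contain earlier coefficients.
\<close>
lemma fps_mult_solve_nth:
  fixes F G :: "'a :: comm_ring_1 fps"
  assumes "G $ 0 = 1" and "k \<ge> 1"
  shows "F $ k = (F * G) $ k - (\<Sum>i = 0..k - 1. F $ i * G $ (k - i))"
proof -
  from \<open>k \<ge> 1\<close> obtain m where k: "k = Suc m"
    by (cases k) auto
  show ?thesis
    unfolding fps_mult_nth k by (simp add: \<open>G $ 0 = 1\<close>)
qed

lemma lambda_fun_holomorphic:
  assumes "s \<ge> 1" and "\<forall>z. norm z \<le> 1 \<longrightarrow> poly (neg_coeff_poly \<beta> q) z \<noteq> 0"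
  shows "lambda_fun d s \<alpha> p \<beta> q holomorphic_on ball 0 1"
proof -
  have "1 - z ^ s \<notin> \<real>\<^sub>\<le>\<^sub>0" if "z \<in> ball 0 1" for z :: complex
    using Re_one_minus_power_pos[of z s] that assms(1) by (auto simp: complex_nonpos_Reals_iff)
  then show ?thesis
    unfolding lambda_fun_def using assms(2) by (intro holomorphic_intros) auto
qed

lemma lambda_fun_times_denominator:
  assumes "norm z < 1" and "s \<ge> 1" and "poly (neg_coeff_poly \<beta> q) z \<noteq> 0"
  shows "lambda_fun d s \<alpha> p \<beta> q z * (poly (neg_coeff_poly \<beta> q) z * (1 - z ^ s) powr of_real d) =
         poly (neg_coeff_poly \<alpha> p) z"
proof -
  have "1 - z ^ s \<noteq> 0"
    using Re_one_minus_power_pos[OF assms(1,2)] by auto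
  then show ?thesis
    using assms(3) by (simp add: lambda_fun_def powr_minus field_simps)
qed

theorem proposition1p1:
  fixes d :: real and s p q :: nat and \<alpha> \<beta> :: "nat \<Rightarrow> real"
  assumes "s \<ge> 1"
    and "\<alpha> 0 = -1" and "\<beta> 0 = -1"
    and "degree (neg_coeff_poly \<alpha> p) = p" and "degree (neg_coeff_poly \<beta> q) = q"
    and "\<not> (\<exists>z. poly (neg_coeff_poly \<alpha> p) z = 0 \<and> poly (neg_coeff_poly \<beta> q) z = 0)"
    and "\<forall>z. norm z \<le> 1 \<longrightarrow> poly (neg_coeff_poly \<beta> q) z \<noteq> 0"
  shows "(\<forall>z. norm z < 1 \<longrightarrow>
            (\<lambda>k. lambda_coeff d s \<alpha> p \<beta> q k * z ^ k) sums lambda_fun d s \<alpha> p \<beta> q z)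
       \<and> lambda_coeff d s \<alpha> p \<beta> q 0 = 1
       \<and> (\<forall>k\<ge>1. lambda_coeff d s \<alpha> p \<beta> q k =
            (if k \<le> p
             then - of_real (\<alpha> k) + (\<Sum>i = 0..k - 1. lambda_coeff d s \<alpha> p \<beta> q i *
                    of_real (\<Sum>j = 0..min (k - i) q. delta_star d (real (k - i - j) / real s) * \<beta> j))
             else (\<Sum>i = 0..k - 1. lambda_coeff d s \<alpha> p \<beta> q i *
                    of_real (\<Sum>j = 0..min (k - i) q. delta_star d (real (k - i - j) / real s) * \<beta> j))))"
proof -
  define L where "L = fps_expansion (lambda_fun d s \<alpha> p \<beta> q) 0"
  define G where "G = fps_of_poly (neg_coeff_poly \<beta> q) *
                        Abs_fps (\<lambda>n. complex_of_real (delta_star d (real n / real s)))"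
  have L_nth: "lambda_coeff d s \<alpha> p \<beta> q k = L $ k" for k
    by (simp add: lambda_coeff_def L_def)
  have G_nth: "G $ n = - of_real (\<Sum>j = 0..min n q. delta_star d (real (n - j) / real s) * \<beta> j)"
    for n
    unfolding G_def by (rule coeff_beta_times_delta_star)
  have G_0: "G $ 0 = 1"
    by (simp add: G_nth delta_star_def delta_def \<open>\<beta> 0 = -1\<close>)

  have holo: "lambda_fun d s \<alpha> p \<beta> q holomorphic_on ball 0 1"
    using assms(1,7) by (rule lambda_fun_holomorphic)
  then have L: "lambda_fun d s \<alpha> p \<beta> q has_fps_expansion L"
    unfolding L_def by (intro has_fps_expansion_fps_expansion[of "ball 0 1"]) auto

  have sums: "(\<lambda>k. L $ k * z ^ k) sums lambda_fun d s \<alpha> p \<beta> q z" if "norm z < 1" for z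
    by (rule has_fps_expansion_imp_sums_complex[OF L, of 1]) (use holo that in auto)

  have "\<forall>\<^sub>F z in nhds 0. lambda_fun d s \<alpha> p \<beta> q z *
        (poly (neg_coeff_poly \<beta> q) z * (1 - z ^ s) powr of_real d) = poly (neg_coeff_poly \<alpha> p) z"
  proof -
    have "eventually (\<lambda>z :: complex. z \<in> ball 0 1) (nhds 0)"
      by (intro eventually_nhds_in_open) auto
    then show ?thesis
      by eventually_elim (use assms(1,7) in \<open>auto intro!: lambda_fun_times_denominator\<close>)
  qed
  moreover have "(\<lambda>z. lambda_fun d s \<alpha> p \<beta> q z *
          (poly (neg_coeff_poly \<beta> q) z * (1 - z ^ s) powr of_real d)) has_fps_expansion L * G"
    unfolding G_def
    by (intro has_fps_expansion_mult L has_fps_expansion_fps_of_poly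
              one_minus_power_powr_has_fps_expansion \<open>s \<ge> 1\<close>)
  ultimately have "poly (neg_coeff_poly \<alpha> p) has_fps_expansion L * G"
    by (rule iffD1[OF has_fps_expansion_cong[OF _ refl]])
  then have LG: "L * G = fps_of_poly (neg_coeff_poly \<alpha> p)"
    using fps_expansion_unique_complex has_fps_expansion_fps_of_poly by blast

  have "(L * G) $ 0 = 1"
    by (simp add: LG coeff_neg_coeff_poly \<open>\<alpha> 0 = -1\<close>)
  then have L_0: "L $ 0 = 1"
    by (simp add: G_0)

  have L_rec: "L $ k = (if k \<le> p then - of_real (\<alpha> k) else 0) + (\<Sum>i = 0..k - 1. L $ i *
      of_real (\<Sum>j = 0..min (k - i) q. delta_star d (real (k - i - j) / real s) * \<beta> j))"
    if "k \<ge> 1" for k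
    using fps_mult_solve_nth[OF G_0 that, of L]
    by (simp add: LG G_nth coeff_neg_coeff_poly sum_negf del: of_real_sum of_real_mult)
  show ?thesis
    unfolding L_nth using sums L_0 L_rec by simp
qed

end
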